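(* Let $n>1$ and let $A(1),A(2),\ldots$ be a sequence of real $n\times n$ matrices, $A(t)=[a_{ij}(t)]$, such that for all $t\ge 1$ and $i\in[n]$ one has $a_{ii}(t)>0$ and $\sum_{j=1}^n|a_{ij}(t)|=1$, and such that there is a number $\beta>0$ with $|a_{ij}(t)|\ge\beta$ whenever $|a_{ij}(t)|>0$, for all $i,j\in[n]$ and $t\ge 1$. Let $\mathbb{G}(t)$ be the signed digraph of $A(t)$, and consider the system $x(t+1)=A(t)x(t)$, $t\ge 1$, $x(t)\in\mathbb{R}^n$. Suppose that the sequence $\mathbb{G}(1),\mathbb{G}(2),\ldots$ is repeatedly jointly strongly connected. Then the system converges to zero exponentially fast for all initial conditions if, and only if, the sequence $\mathbb{G}(1),\mathbb{G}(2),\ldots$ is repeatedly jointly structurally unbalanced.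
   Context: $[n]=\{1,\ldots,n\}$. The signed digraph of $A(t)$ has vertex set $[n]$ and an arc $(i,j)$ from $i$ to $j$ exactly when $a_{ji}(t)\neq 0$; the sign of $(i,j)$ is the sign of $a_{ji}(t)$. (In particular all self-arcs are present and positive.) Signed digraphs may be signed multidigraphs: for an ordered pair of distinct vertices $i,j$ there may be both a positive and a negative arc from $i$ to $j$. The union of finitely many signed digraphs on the same vertex set is the signed digraph on that vertex set whose signed arc set is the union of the signed arc sets. A signed digraph is strongly connected if, ignoring signs, there is a directed path between each ordered pair of distinct vertices. A signed digraph is structurally balanced if its vertices can be partitioned into two sets (one possibly empty) such that each arc connecting two vertices in the same set is positive and each arc connecting two vertices in different sets is negative; otherwise it is structurally unbalanced. A finite sequence of signed digraphs on the same vertex set is jointly strongly connected (resp. jointly structurally unbalanced) if its union is strongly connected (resp. structurally unbalanced). An infinite sequence $\mathbb{G}_1,\mathbb{G}_2,\ldots$ is repeatedly jointly strongly connected (resp. repeatedly jointly structurally unbalanced) if there exist positive integers $p,q$ such that for every $k\ge 0$ the finite sequence $\mathbb{G}_{q+kp},\mathbb{G}_{q+kp+1},\ldots,\mathbb{G}_{q+(k+1)p-1}$ is jointly strongly connected (resp. jointly structurally unbalanced). "Converges to zero exponentially fast for all initial conditions" means exponential stability of the time-varying linear system: there are constants $C\ge 0$ and $\lambda\in[0,1)$ such that for every initial time $\tau\ge 1$, every initial state $x(\tau)\in\mathbb{R}^n$ and every $t\ge\tau$, the solution satisfies $\|x(t)\|\le C\lambda^{t-\tau}\|x(\tau)\|$.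 *)

theory Defs
  imports "HOL-Analysis.Analysis"
begin

datatype arc_sign = Positive | Negative

text \<open>A signed digraph whose vertex set is the whole type \<open>'v\<close>, given by its set of signed
  arcs \<open>(i, j, s)\<close>, with tail \<open>i\<close>, head \<open>j\<close> and sign \<open>s\<close>. Two arcs
  between the same vertices may differ in sign, so signed multidigraphs are included.\<close>

type_synonym 'v signed_digraph = "('v \<times> 'v \<times> arc_sign) set"

definition sign_of :: "real \<Rightarrow> arc_sign" where
  "sign_of a = (if a > 0 then Positive else Negative)"

text \<open>The arc from \<open>i\<close> to \<open>j\<close> comes from the entry in row \<open>j\<close>, column
  \<open>i\<close>. As \<^const>\<open>sign_of\<close> is only applied to nonzero entries, its value at zero
  is irrelevant.\<close>

definition signed_digraph_of :: "real ^ 'n ^ 'n \<Rightarrow> 'n signed_digraph" where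
  "signed_digraph_of M = {(i, j, sign_of (M $ j $ i)) | i j. M $ j $ i \<noteq> 0}"

definition strongly_connected :: "'v signed_digraph \<Rightarrow> bool" where
  "strongly_connected G \<longleftrightarrow>
     (\<forall>i j. i \<noteq> j \<longrightarrow> (i, j) \<in> {(u, v). \<exists>s. (u, v, s) \<in> G}\<^sup>+)"

definition structurally_balanced :: "'v signed_digraph \<Rightarrow> bool" where
  "structurally_balanced G \<longleftrightarrow>
     (\<exists>U W. U \<union> W = UNIV \<and> U \<inter> W = {} \<and>
        (\<forall>(i, j, s) \<in> G.
           (i \<in> U \<and> j \<in> U \<or> i \<in> W \<and> j \<in> W \<longrightarrow> s = Positive) \<and>
           (i \<in> U \<and> j \<in> W \<or> i \<in> W \<and> j \<in> U \<longrightarrow> s = Negative)))"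

definition structurally_unbalanced :: "'v signed_digraph \<Rightarrow> bool" where
  "structurally_unbalanced G \<longleftrightarrow> \<not> structurally_balanced G"

definition jointly_strongly_connected :: "'v signed_digraph list \<Rightarrow> bool" where
  "jointly_strongly_connected Gs \<longleftrightarrow> strongly_connected (\<Union> (set Gs))"

definition jointly_structurally_unbalanced :: "'v signed_digraph list \<Rightarrow> bool" where
  "jointly_structurally_unbalanced Gs \<longleftrightarrow> structurally_unbalanced (\<Union> (set Gs))"

text \<open>Infinite sequences are indexed by the positive integers; the value at index 0 is never
  used, because \<open>q\<close> is positive.\<close>

definition repeatedly ::
    "('v signed_digraph list \<Rightarrow> bool) \<Rightarrow> (nat \<Rightarrow> 'v signed_digraph) \<Rightarrow> bool" where
  "repeatedly P G \<longleftrightarrow>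
     (\<exists>p>0. \<exists>q>0. \<forall>k. P (map G [q + k * p ..< q + (k + 1) * p]))"

definition repeatedly_jointly_strongly_connected ::
    "(nat \<Rightarrow> 'v signed_digraph) \<Rightarrow> bool" where
  "repeatedly_jointly_strongly_connected = repeatedly jointly_strongly_connected"

definition repeatedly_jointly_structurally_unbalanced ::
    "(nat \<Rightarrow> 'v signed_digraph) \<Rightarrow> bool" where
  "repeatedly_jointly_structurally_unbalanced = repeatedly jointly_structurally_unbalanced"

definition solution_from ::
    "nat \<Rightarrow> (nat \<Rightarrow> real ^ 'n ^ 'n) \<Rightarrow> (nat \<Rightarrow> real ^ 'n) \<Rightarrow> bool" where
  "solution_from \<tau> A x \<longleftrightarrow> (\<forall>t\<ge>\<tau>. x (t + 1) = A t *v x t)"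

text \<open>Uniform exponential stability: \<open>C\<close> and \<open>\<rho>\<close> depend neither on the
  initial time nor on the initial state. For \<open>\<rho> = 0\<close>, note that \<open>0 ^ 0 = 1\<close>.\<close>

definition converges_to_zero_exponentially_fast :: "(nat \<Rightarrow> real ^ 'n ^ 'n) \<Rightarrow> bool" where
  "converges_to_zero_exponentially_fast A \<longleftrightarrow>
     (\<exists>C \<rho> :: real. C \<ge> 0 \<and> 0 \<le> \<rho> \<and> \<rho> < 1 \<and>
        (\<forall>\<tau>\<ge>1. \<forall>x. solution_from \<tau> A x \<longrightarrow>
           (\<forall>t\<ge>\<tau>. norm (x t) \<le> C * \<rho> ^ (t - \<tau>) * norm (x \<tau>))))"

end

theory Submission
  imports Defs
begin

text \<open>The key device is the double cover of a signed digraph: its vertices are pairs of a vertex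
  and a sign, and an arc from \<open>i\<close> to \<open>j\<close> of sign \<open>s\<close> leads from
  \<open>(i, r)\<close> to \<open>(j, s r)\<close>. If the digraph is strongly connected and structurally
  unbalanced, no proper nonempty set of pairs is closed under these lifted arcs
  (\<open>lifted_closed_UNIV\<close>): a closed set containing exactly one of \<open>(i, +)\<close>,
  \<open>(i, -)\<close> for each \<open>i\<close> would be a balancing partition.

  For sufficiency, regard \<open>r x\<^sub>i\<close> as the value at the pair \<open>(i, r)\<close>. Each step replaces
  these values by convex combinations along lifted arcs, so none exceeds
  \<open>M = \<parallel>x(\<tau>)\<parallel>\<^sub>\<infinity>\<close>. Initially some pair has a value at most 0. The pairs whose value at
  time \<open>\<tau> + m\<close> is at most \<open>(1 - \<beta>\<^sup>m) M\<close> are propagated along the lifted arcs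
  (\<open>deficit_step\<close>), and never lost because of the positive self-arcs. In each window
  that is jointly strongly connected and unbalanced, their set therefore grows until it contains
  every pair; at that moment the sup norm has shrunk by a fixed factor
  (\<open>infnorm_contraction\<close>). Together with the monotonicity of the sup norm, this gives a uniform
  exponential rate.

  For necessity, the \<open>\<plusminus>1\<close> vector of a partition balancing all digraphs of a window is
  fixed by every matrix of that window. If the sequence were not repeatedly unbalanced, such
  windows would exist with every length, contradicting uniform exponential decay.\<close>

section \<open>The double cover of a signed digraph\<close>

fun sign_mult :: "arc_sign \<Rightarrow> arc_sign \<Rightarrow> arc_sign" where
  "sign_mult Positive r = r"
| "sign_mult Negative Positive = Negative"
| "sign_mult Negative Negative = Positive"

fun sign_val :: "arc_sign \<Rightarrow> real" where
  "sign_val Positive = 1"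
| "sign_val Negative = - 1"

lemma sign_val_mult: "sign_val (sign_mult s r) = sign_val s * sign_val r"
  by (cases s; cases r) auto

lemma abs_sign_val [simp]: "\<bar>sign_val s\<bar> = 1"
  by (cases s) auto

lemma sign_val_sign_of: "a \<noteq> 0 \<Longrightarrow> sign_val (sign_of a) * a = \<bar>a\<bar>"
  by (auto simp: sign_of_def)

lemma sign_exhaust: "s = Positive \<or> s = Negative"
  by (cases s) auto

lemma finite_signed_vertices: "finite (UNIV :: ('v::finite \<times> arc_sign) set)"
proof -
  have "(UNIV :: arc_sign set) = {Positive, Negative}"
    using sign_exhaust by auto
  then have "finite (UNIV :: arc_sign set)"
    by (metis finite.emptyI finite.insertI)
  then show ?thesis
    by (intro finite_Prod_UNIV) auto
qed

definition lifted_closed :: "'v signed_digraph \<Rightarrow> ('v \<times> arc_sign) set \<Rightarrow> bool" where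
  "lifted_closed G R \<longleftrightarrow>
     (\<forall>i j s r. (i, j, s) \<in> G \<longrightarrow> (i, r) \<in> R \<longrightarrow> (j, sign_mult s r) \<in> R)"

lemma strongly_connected_closed_UNIV:
  assumes "strongly_connected G" and "i \<in> V"
    and closed: "\<And>i j s. (i, j, s) \<in> G \<Longrightarrow> i \<in> V \<Longrightarrow> j \<in> V"
  shows "V = UNIV"
proof -
  have "j \<in> V" for j
  proof (cases "i = j")
    case False
    then have "(i, j) \<in> {(u, v). \<exists>s. (u, v, s) \<in> G}\<^sup>+"
      using assms(1) by (auto simp: strongly_connected_def)
    then show ?thesis
      by (induction rule: trancl_induct) (use \<open>i \<in> V\<close> closed in blast)+
  qed (use \<open>i \<in> V\<close> in simp)
  then show ?thesis by auto
qed

text \<open>The vertices carrying at least one sign in \<open>R\<close> form an arc-closed set, and so do the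
  vertices carrying both signs. By strong connectivity, the first set is everything, and
  the second is everything or empty. It is not empty, since otherwise the sign carried by each
  vertex would define a balancing partition.\<close>

lemma lifted_closed_UNIV:
  assumes sc: "strongly_connected G" and ub: "structurally_unbalanced G"
    and closed: "lifted_closed G R" and "R \<noteq> {}"
  shows "R = UNIV"
proof -
  have step: "(j, sign_mult s r) \<in> R" if "(i, j, s) \<in> G" "(i, r) \<in> R" for i j s r
    using closed that by (auto simp: lifted_closed_def)
  have some: "fst ` R = UNIV"
  proof -
    obtain v where "v \<in> R" using \<open>R \<noteq> {}\<close> by auto
    then have "fst v \<in> fst ` R" by auto
    then show ?thesis
      by (rule strongly_connected_closed_UNIV [OF sc]) (force dest: step)
  qed
  define D where "D = {i. (i, Positive) \<in> R \<and> (i, Negative) \<in> R}"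
  have "D \<noteq> {}"
  proof
    assume "D = {}"
    define U where "U = {i. (i, Positive) \<in> R}"
    have neg: "(i, Negative) \<in> R \<longleftrightarrow> i \<notin> U" for i
    proof
      assume "i \<notin> U"
      obtain r where "(i, r) \<in> R" using some by (metis UNIV_I fst_conv imageE surj_pair)
      then show "(i, Negative) \<in> R"
        using \<open>i \<notin> U\<close> by (cases r) (auto simp: U_def)
    qed (use \<open>D = {}\<close> in \<open>auto simp: U_def D_def\<close>)
    have "(i \<in> U \<longleftrightarrow> j \<in> U) \<longleftrightarrow> s = Positive" if "(i, j, s) \<in> G" for i j s
    proof (cases "i \<in> U")
      case True
      then have "(j, sign_mult s Positive) \<in> R"
        using step that by (auto simp: U_def)
      with True show ?thesis
        using neg [of j] by (cases s) (auto simp: U_def)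
    next
      case False
      then have "(j, sign_mult s Negative) \<in> R"
        using step that neg by auto
      with False show ?thesis
        using neg [of j] by (cases s) (auto simp: U_def)
    qed
    then have "structurally_balanced G"
      unfolding structurally_balanced_def
      by (intro exI [of _ U] exI [of _ "- U"]) (use sign_exhaust in blast)
    with ub show False by (simp add: structurally_unbalanced_def)
  qed
  then obtain i where "i \<in> D" by auto
  then have "D = UNIV"
  proof (rule strongly_connected_closed_UNIV [OF sc])
    fix i j s assume "(i, j, s) \<in> G" "i \<in> D"
    then have "(j, sign_mult s Positive) \<in> R" "(j, sign_mult s Negative) \<in> R"
      using step by (auto simp: D_def)
    then show "j \<in> D" by (cases s) (auto simp: D_def)
  qed
  then have "(i, r) \<in> R" for i r
    by (cases r) (auto simp: D_def)
  then show ?thesis by auto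
qed

lemma strongly_connected_mono:
  assumes "strongly_connected G" "G \<subseteq> H"
  shows "strongly_connected H"
proof -
  have "{(u, v). \<exists>s. (u, v, s) \<in> G} \<subseteq> {(u, v). \<exists>s. (u, v, s) \<in> H}"
    using assms(2) by auto
  from trancl_mono_subset [OF this] show ?thesis
    using assms(1) unfolding strongly_connected_def by blast
qed

lemma structurally_unbalanced_mono:
  assumes "structurally_unbalanced G" "G \<subseteq> H"
  shows "structurally_unbalanced H"
  unfolding structurally_unbalanced_def
proof
  assume "structurally_balanced H"
  with \<open>G \<subseteq> H\<close> have "structurally_balanced G"
    unfolding structurally_balanced_def
    by (elim ex_forward conj_forward) (assumption | rule ballI, drule (1) subsetD, erule (1) bspec)+
  with assms(1) show False
    by (simp add: structurally_unbalanced_def)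
qed

lemma jointly_strongly_connected_mono:
  "jointly_strongly_connected Gs \<Longrightarrow> set Gs \<subseteq> set Hs \<Longrightarrow> jointly_strongly_connected Hs"
  unfolding jointly_strongly_connected_def by (erule strongly_connected_mono) blast

lemma jointly_structurally_unbalanced_mono:
  "jointly_structurally_unbalanced Gs \<Longrightarrow> set Gs \<subseteq> set Hs
    \<Longrightarrow> jointly_structurally_unbalanced Hs"
  unfolding jointly_structurally_unbalanced_def by (erule structurally_unbalanced_mono) blast

section \<open>Windows\<close>

text \<open>Any window of length at least \<open>2 p\<close> starting no earlier than \<open>q\<close> contains one of
  the aligned windows of length \<open>p\<close>. This removes the alignment, so that windows
  for two different properties can be intersected.\<close>

lemma repeatedly_imp_all_long_windows:
  assumes "repeatedly P G"
    and mono: "\<And>Gs Hs. P Gs \<Longrightarrow> set Gs \<subseteq> set Hs \<Longrightarrow> P Hs"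
  obtains p q :: nat where "\<And>t r. t \<ge> q \<Longrightarrow> r \<ge> p \<Longrightarrow> P (map G [t ..< t + r])"
proof -
  obtain p q where "p > 0"
    and pq: "\<And>k. P (map G [q + k * p ..< q + (k + 1) * p])"
    using assms(1) by (auto simp: repeatedly_def)
  have "P (map G [t ..< t + r])" if "t \<ge> q" "r \<ge> 2 * p" for t r
  proof -
    define k where "k = (t - q) div p + 1"
    have "k * p + (t - q) mod p = t - q + p" "(t - q) mod p < p"
      using \<open>p > 0\<close> by (auto simp: k_def)
    then have "t \<le> q + k * p" "q + (k + 1) * p \<le> t + r"
      using that unfolding add_mult_distrib by linarith+
    then show ?thesis
      by (intro mono [OF pq [of k]]) auto
  qed
  then show ?thesis using that by blast
qed

text \<open>If an increasing sequence of subsets of a finite type can only stall once it is everything,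
  then it is everything after as many steps as the type has elements.\<close>

lemma increasing_sets_exhaust:
  fixes T :: "nat \<Rightarrow> 'a set"
  assumes fin: "finite (UNIV :: 'a set)" and "T 0 \<noteq> {}"
    and inc: "\<And>k. T k \<subseteq> T (Suc k)"
    and stall: "\<And>k. T (Suc k) = T k \<Longrightarrow> T k = UNIV"
  shows "T (card (UNIV :: 'a set)) = UNIV"
proof -
  have fT: "finite (T k)" for k using fin by (rule finite_subset [rotated]) simp
  have "T k = UNIV \<or> k < card (T k)" for k
  proof (induction k)
    case 0
    then show ?case using \<open>T 0 \<noteq> {}\<close> fT by (auto simp: card_gt_0_iff)
  next
    case (Suc k)
    show ?case
    proof (cases "T k = UNIV")
      case True
      then show ?thesis using inc [of k] by auto
    next
      case False
      then have "T k \<subset> T (Suc k)" using inc [of k] stall [of k] by auto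
      then have "card (T k) < card (T (Suc k))" by (rule psubset_card_mono [OF fT])
      then show ?thesis using Suc.IH False by linarith
    qed
  qed
  then show ?thesis
    using card_mono [OF fin subset_UNIV] by (metis linorder_not_less)
qed

text \<open>The principle behind the contraction: sets that follow the lifted arcs, and never lose a
  pair, swallow the whole double cover within as many windows as it has vertices.\<close>

lemma lifted_spread:
  fixes G :: "nat \<Rightarrow> 'v::finite signed_digraph" and S :: "nat \<Rightarrow> ('v \<times> arc_sign) set"
  defines "N \<equiv> card (UNIV :: ('v \<times> arc_sign) set)"
  assumes "S \<tau> \<noteq> {}"
    and inc: "\<And>t. t \<ge> \<tau> \<Longrightarrow> S t \<subseteq> S (Suc t)"
    and arcs: "\<And>t i j s r. t \<ge> \<tau> \<Longrightarrow> (i, j, s) \<in> G t \<Longrightarrow> (i, r) \<in> S t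
                 \<Longrightarrow> (j, sign_mult s r) \<in> S (Suc t)"
    and sc: "\<And>t. t \<ge> \<tau> \<Longrightarrow> jointly_strongly_connected (map G [t ..< t + p])"
    and ub: "\<And>t. t \<ge> \<tau> \<Longrightarrow> jointly_structurally_unbalanced (map G [t ..< t + p])"
  shows "S (\<tau> + N * p) = UNIV"
proof -
  have mono: "S t \<subseteq> S (t + m)" if "t \<ge> \<tau>" for t m
  proof (induction m)
    case (Suc m)
    then show ?case using inc [of "t + m"] that by auto
  qed simp
  have "S (\<tau> + N * p) = UNIV"
    unfolding N_def
  proof (rule increasing_sets_exhaust [where T = "\<lambda>k. S (\<tau> + k * p)"])
    show "finite (UNIV :: ('v \<times> arc_sign) set)" by (rule finite_signed_vertices)
    show "S (\<tau> + 0 * p) \<noteq> {}" using assms(2) by simp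
    show "S (\<tau> + k * p) \<subseteq> S (\<tau> + Suc k * p)" for k
      using mono [of "\<tau> + k * p" p] by (simp add: algebra_simps)
    fix k
    let ?t = "\<tau> + k * p"
    assume stall: "S (\<tau> + Suc k * p) = S ?t"
    \<comment> \<open>A stall freezes the set throughout the window, so that it is closed under every arc of it.\<close>
    have const: "S t = S ?t" if "?t \<le> t" "t \<le> ?t + p" for t
    proof
      show "S ?t \<subseteq> S t" using mono [of ?t "t - ?t"] that by simp
      have "t + (?t + p - t) = \<tau> + Suc k * p" using that by simp
      moreover have "S t \<subseteq> S (t + (?t + p - t))" using mono that by (metis le_add1 le_trans)
      ultimately show "S t \<subseteq> S ?t" using stall by simp
    qed
    have "lifted_closed (\<Union> (set (map G [?t ..< ?t + p]))) (S ?t)"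
      unfolding lifted_closed_def
    proof (intro allI impI)
      fix i j s r
      assume "(i, j, s) \<in> \<Union> (set (map G [?t ..< ?t + p]))" and r: "(i, r) \<in> S ?t"
      then obtain t where t: "?t \<le> t" "t < ?t + p" "(i, j, s) \<in> G t" by auto
      have "(j, sign_mult s r) \<in> S (Suc t)"
        by (rule arcs) (use t r const [of t] in auto)
      then show "(j, sign_mult s r) \<in> S ?t"
        using const [of "Suc t"] t by simp
    qed
    moreover have "S ?t \<noteq> {}" using mono [of \<tau> "k * p"] assms(2) by auto
    ultimately show "S ?t = UNIV"
      using sc [of ?t] ub [of ?t] lifted_closed_UNIV
      by (auto simp: jointly_strongly_connected_def jointly_structurally_unbalanced_def)
  qed
  then show ?thesis .
qed

section \<open>Contraction of the sup norm\<close>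

lemma infnorm_le_cart:
  fixes x :: "real ^ 'n"
  assumes "\<And>i. \<bar>x $ i\<bar> \<le> M"
  shows "infnorm x \<le> M"
  unfolding infnorm_cart by (rule cSup_least) (use assms in auto)

lemma abs_matrix_vector_le:
  fixes M :: "real ^ 'n ^ 'n"
  assumes "(\<Sum>j\<in>UNIV. \<bar>M $ i $ j\<bar>) = 1"
  shows "\<bar>(M *v x) $ i\<bar> \<le> infnorm x"
proof -
  have "\<bar>(M *v x) $ i\<bar> \<le> (\<Sum>j\<in>UNIV. \<bar>M $ i $ j * x $ j\<bar>)"
    unfolding matrix_vector_mult_def by (simp add: sum_abs)
  also have "\<dots> \<le> (\<Sum>j\<in>UNIV. \<bar>M $ i $ j\<bar> * infnorm x)"
    by (intro sum_mono) (simp add: abs_mult mult_left_mono component_le_infnorm_cart)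
  finally show ?thesis
    using assms by (simp flip: sum_distrib_right)
qed

text \<open>A gap \<open>\<delta> B\<close> below the bound \<open>B\<close> at the pair \<open>(j, r)\<close> is transmitted
  along the lifted arc leaving it, shrunk by at most the weight of the arc; all other terms of the
  row are estimated by \<open>B\<close>.\<close>

lemma deficit_step:
  fixes M :: "real ^ 'n ^ 'n"
  assumes row: "(\<Sum>k\<in>UNIV. \<bar>M $ i $ k\<bar>) = 1"
    and arc: "M $ i $ j \<noteq> 0" and beta: "\<bar>M $ i $ j\<bar> \<ge> \<beta>"
    and bound: "\<And>k. \<bar>x $ k\<bar> \<le> B" and "\<delta> \<ge> 0"
    and gap: "sign_val r * x $ j \<le> (1 - \<delta>) * B"
  shows "sign_val (sign_mult (sign_of (M $ i $ j)) r) * (M *v x) $ i \<le> (1 - \<beta> * \<delta>) * B"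
proof -
  let ?\<sigma> = "sign_val (sign_mult (sign_of (M $ i $ j)) r)"
  have "B \<ge> 0" using bound [of j] by linarith
  have j: "?\<sigma> * (M $ i $ j * x $ j) = \<bar>M $ i $ j\<bar> * (sign_val r * x $ j)"
    using sign_val_sign_of [OF arc] by (metis sign_val_mult mult.assoc mult.commute)
  have "?\<sigma> * (M *v x) $ i = (\<Sum>k\<in>UNIV. ?\<sigma> * (M $ i $ k * x $ k))"
    by (simp add: matrix_vector_mult_def sum_distrib_left)
  also have "\<dots> \<le> (\<Sum>k\<in>UNIV. \<bar>M $ i $ k\<bar> * B - (if k = j then \<bar>M $ i $ j\<bar> * (\<delta> * B) else 0))"
  proof (rule sum_mono)
    fix k
    have "?\<sigma> * (M $ i $ k * x $ k) \<le> \<bar>?\<sigma> * (M $ i $ k * x $ k)\<bar>" by (rule abs_ge_self)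
    also have "\<dots> \<le> \<bar>M $ i $ k\<bar> * B"
      by (simp add: abs_mult mult_left_mono bound)
    finally have "?\<sigma> * (M $ i $ k * x $ k) \<le> \<bar>M $ i $ k\<bar> * B" .
    moreover have "\<bar>M $ i $ j\<bar> * (sign_val r * x $ j) \<le> \<bar>M $ i $ j\<bar> * ((1 - \<delta>) * B)"
      by (intro mult_left_mono gap) auto
    ultimately show "?\<sigma> * (M $ i $ k * x $ k)
        \<le> \<bar>M $ i $ k\<bar> * B - (if k = j then \<bar>M $ i $ j\<bar> * (\<delta> * B) else 0)"
      using j by (auto simp: algebra_simps)
  qed
  also have "\<dots> = B - \<bar>M $ i $ j\<bar> * (\<delta> * B)"
    using row by (simp add: sum_subtractf flip: sum_distrib_right)
  also have "\<dots> \<le> (1 - \<beta> * \<delta>) * B"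
    using mult_right_mono [OF beta, of "\<delta> * B"] \<open>B \<ge> 0\<close> \<open>\<delta> \<ge> 0\<close>
    by (simp add: algebra_simps)
  finally show ?thesis .
qed

text \<open>The set of pairs whose value is at most \<open>(1 - \<beta>\<^sup>m) \<parallel>x(\<tau>)\<parallel>\<^sub>\<infinity>\<close> after
  \<open>m\<close> steps spreads by the previous lemma until it contains both \<open>(i, +)\<close> and
  \<open>(i, -)\<close> for every \<open>i\<close>, which bounds \<open>\<bar>x\<^sub>i\<bar>\<close>.\<close>

lemma infnorm_contraction:
  fixes A :: "nat \<Rightarrow> real ^ 'n ^ 'n"
  defines "N \<equiv> card (UNIV :: ('n \<times> arc_sign) set)"
  assumes diag: "\<And>t i. t \<ge> \<tau> \<Longrightarrow> A t $ i $ i > 0"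
    and row: "\<And>t i. t \<ge> \<tau> \<Longrightarrow> (\<Sum>j\<in>UNIV. \<bar>A t $ i $ j\<bar>) = 1"
    and beta: "\<And>t i j. t \<ge> \<tau> \<Longrightarrow> A t $ i $ j \<noteq> 0 \<Longrightarrow> \<bar>A t $ i $ j\<bar> \<ge> \<beta>"
    and "\<beta> > 0"
    and sol: "solution_from \<tau> A x"
    and sc: "\<And>t. t \<ge> \<tau> \<Longrightarrow>
      jointly_strongly_connected (map (\<lambda>t. signed_digraph_of (A t)) [t ..< t + p])"
    and ub: "\<And>t. t \<ge> \<tau> \<Longrightarrow>
      jointly_structurally_unbalanced (map (\<lambda>t. signed_digraph_of (A t)) [t ..< t + p])"
  shows "infnorm (x (\<tau> + N * p)) \<le> (1 - \<beta> ^ (N * p)) * infnorm (x \<tau>)"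
proof -
  let ?B = "infnorm (x \<tau>)"
  have next_x: "x (Suc t) = A t *v x t" if "t \<ge> \<tau>" for t
    using sol that by (simp add: solution_from_def)
  have bound: "\<bar>x t $ k\<bar> \<le> ?B" if "t \<ge> \<tau>" for t k
    using that
  proof (induction t arbitrary: k rule: dec_induct)
    case base
    then show ?case by (rule component_le_infnorm_cart)
  next
    case (step t)
    then have "\<bar>x (Suc t) $ k\<bar> \<le> infnorm (x t)"
      using next_x row abs_matrix_vector_le by metis
    also have "\<dots> \<le> ?B" using step.IH by (rule infnorm_le_cart)
    finally show ?case .
  qed
  define S where "S t = {(i, r). sign_val r * x t $ i \<le> (1 - \<beta> ^ (t - \<tau>)) * ?B}" for t
  have spread: "(i, sign_mult (sign_of (A t $ i $ j)) r) \<in> S (Suc t)"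
    if "t \<ge> \<tau>" "A t $ i $ j \<noteq> 0" "(j, r) \<in> S t" for t i j r
  proof -
    have "sign_val (sign_mult (sign_of (A t $ i $ j)) r) * (A t *v x t) $ i
        \<le> (1 - \<beta> * \<beta> ^ (t - \<tau>)) * ?B"
      by (rule deficit_step) (use that row beta bound \<open>\<beta> > 0\<close> in \<open>auto simp: S_def\<close>)
    then show ?thesis
      using that next_x by (simp add: S_def Suc_diff_le)
  qed
  have "S (\<tau> + N * p) = UNIV"
    unfolding N_def
  proof (rule lifted_spread [where G = "\<lambda>t. signed_digraph_of (A t)"])
    \<comment> \<open>One of the two signed values at any vertex is nonpositive.\<close>
    fix i :: 'n
    have "(i, if x \<tau> $ i \<le> 0 then Positive else Negative) \<in> S \<tau>"
      by (auto simp: S_def)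
    then show "S \<tau> \<noteq> {}" by auto
  next
    fix t assume "t \<ge> \<tau>"
    show "S t \<subseteq> S (Suc t)"
    proof
      fix v assume "v \<in> S t"
      then have "(fst v, sign_mult (sign_of (A t $ fst v $ fst v)) (snd v)) \<in> S (Suc t)"
        using \<open>t \<ge> \<tau>\<close> diag [of t "fst v"] by (intro spread) auto
      then show "v \<in> S (Suc t)"
        using diag [OF \<open>t \<ge> \<tau>\<close>, of "fst v"] by (simp add: sign_of_def)
    qed
  next
    fix t i j s r assume "t \<ge> \<tau>" "(i, j, s) \<in> signed_digraph_of (A t)" "(i, r) \<in> S t"
    then show "(j, sign_mult s r) \<in> S (Suc t)"
      using spread by (auto simp: signed_digraph_of_def)
  qed (use sc ub in auto)
  then have all: "sign_val r * x (\<tau> + N * p) $ i \<le> (1 - \<beta> ^ (N * p)) * ?B" for i r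
    unfolding S_def by auto
  show ?thesis
    by (rule infnorm_le_cart, rule abs_leI) (use all [of Positive] all [of Negative] in auto)
qed

text \<open>The rate is the \<open>L\<close>-th root of \<open>\<theta>\<close>; the constant pays for the initial segment
  before \<open>q\<close> and for the last incomplete block of length \<open>L\<close>. Positivity of \<open>\<theta>\<close> is
  needed because the constant is a negative power of the rate.\<close>

lemma geometric_decay_of_block_contraction:
  fixes \<theta> :: real and L q :: nat
  assumes "0 < \<theta>" "\<theta> < 1" "L > 0"
  obtains C \<rho> :: real where "C \<ge> 0" "0 \<le> \<rho>" "\<rho> < 1"
    and "\<And>(f :: nat \<Rightarrow> real) \<tau> t. \<lbrakk>f \<tau> \<ge> 0; \<And>t. t \<ge> \<tau> \<Longrightarrow> f (Suc t) \<le> f t;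
           \<And>t. t \<ge> \<tau> \<Longrightarrow> t \<ge> q \<Longrightarrow> f (t + L) \<le> \<theta> * f t; t \<ge> \<tau>\<rbrakk>
           \<Longrightarrow> f t \<le> C * \<rho> ^ (t - \<tau>) * f \<tau>"
proof -
  define \<rho> where "\<rho> = root L \<theta>"
  have \<rho>: "0 < \<rho>" "\<rho> < 1" "\<rho> ^ L = \<theta>"
    using assms by (auto simp: \<rho>_def)
  define C where "C = 1 / \<rho> ^ (q + L)"
  have "f t \<le> C * \<rho> ^ (t - \<tau>) * f \<tau>"
    if f0: "f \<tau> \<ge> 0" and dec: "\<And>t. t \<ge> \<tau> \<Longrightarrow> f (Suc t) \<le> f t"
      and blk: "\<And>t. t \<ge> \<tau> \<Longrightarrow> t \<ge> q \<Longrightarrow> f (t + L) \<le> \<theta> * f t" and "t \<ge> \<tau>"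
    for f :: "nat \<Rightarrow> real" and \<tau> t
  proof -
    have anti: "f b \<le> f a" if "\<tau> \<le> a" "a \<le> b" for a b
      using that(2)
    proof (induction b rule: dec_induct)
      case (step b)
      then show ?case using dec [of b] that(1) by linarith
    qed simp
    have blocks: "f (\<tau> + q + k * L) \<le> \<theta> ^ k * f \<tau>" for k
    proof (induction k)
      case 0
      then show ?case using anti [of \<tau> "\<tau> + q"] by simp
    next
      case (Suc k)
      have "f (\<tau> + q + k * L + L) \<le> \<theta> * f (\<tau> + q + k * L)" by (rule blk) auto
      also have "\<dots> \<le> \<theta> * (\<theta> ^ k * f \<tau>)"
        using Suc.IH assms by (intro mult_left_mono) auto
      finally show ?case by (simp add: algebra_simps)
    qed
    \<comment> \<open>Truncated subtraction makes \<open>k = 0\<close> when \<open>t\<close> lies in the initial segment.\<close>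
    define k where "k = (t - \<tau> - q) div L"
    have k: "k * L \<le> t - \<tau> - q" "t - \<tau> \<le> q + L + L * k"
    proof -
      have "L * k + (t - \<tau> - q) mod L = t - \<tau> - q" "(t - \<tau> - q) mod L < L"
        using \<open>L > 0\<close> by (auto simp: k_def)
      then show "k * L \<le> t - \<tau> - q" "t - \<tau> \<le> q + L + L * k"
        by (auto simp: algebra_simps)
    qed
    have "f t \<le> \<theta> ^ k * f \<tau>"
    proof (cases "t - \<tau> \<ge> q")
      case True
      then have "f t \<le> f (\<tau> + q + k * L)" using k(1) \<open>t \<ge> \<tau>\<close> by (intro anti) linarith+
      then show ?thesis using blocks [of k] by linarith
    next
      case False
      then have "k = 0" by (simp add: k_def)
      then show ?thesis using anti [of \<tau> t] \<open>t \<ge> \<tau>\<close> by simp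
    qed
    also have "\<dots> \<le> C * \<rho> ^ (t - \<tau>) * f \<tau>"
    proof (rule mult_right_mono [OF _ f0])
      have "\<rho> ^ (q + L + L * k) \<le> \<rho> ^ (t - \<tau>)"
        using k(2) \<rho> by (intro power_decreasing) auto
      then have "\<rho> ^ (q + L) * \<theta> ^ k \<le> \<rho> ^ (t - \<tau>)"
        by (simp add: power_add power_mult \<rho>(3))
      then show "\<theta> ^ k \<le> C * \<rho> ^ (t - \<tau>)"
        using \<rho>(1) by (simp add: C_def field_simps)
    qed
    finally show ?thesis .
  qed
  note decay = this
  have "C \<ge> 0" "0 \<le> \<rho>" using \<rho> by (simp_all add: C_def)
  then show ?thesis by (rule that [OF _ _ \<rho>(2) decay])
qed

section \<open>Balanced windows\<close>

lemma solution_from_exists: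
  obtains x where "solution_from \<tau> A x" "x \<tau> = x0"
proof -
  define z where "z = rec_nat x0 (\<lambda>k y. A (\<tau> + k) *v y)"
  have "solution_from \<tau> A (\<lambda>t. z (t - \<tau>))"
    by (auto simp: solution_from_def z_def Suc_diff_le)
  moreover have "z (\<tau> - \<tau>) = x0" by (simp add: z_def)
  ultimately show ?thesis using that by blast
qed

text \<open>Let \<open>u\<close> be \<open>1\<close> on one part of the partition and \<open>- 1\<close> on the other. Balance
  says \<open>a\<^sub>i\<^sub>j u\<^sub>j = \<bar>a\<^sub>i\<^sub>j\<bar> u\<^sub>i\<close>; summing over \<open>j\<close> shows that
  \<open>u\<close> is fixed.\<close>

lemma balanced_window_fixed_vector:
  fixes A :: "nat \<Rightarrow> real ^ 'n ^ 'n"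
  assumes row: "\<And>t i. t \<in> T \<Longrightarrow> (\<Sum>j\<in>UNIV. \<bar>A t $ i $ j\<bar>) = 1"
    and bal: "structurally_balanced (\<Union>t\<in>T. signed_digraph_of (A t))"
  obtains u :: "real ^ 'n" where "u \<noteq> 0" "\<And>t. t \<in> T \<Longrightarrow> A t *v u = u"
proof -
  define G where "G = (\<Union>t\<in>T. signed_digraph_of (A t))"
  obtain U W :: "'n set" where UW: "U \<union> W = UNIV" "U \<inter> W = {}"
    and arcs: "\<forall>(i, j, s)\<in>G.
        (i \<in> U \<and> j \<in> U \<or> i \<in> W \<and> j \<in> W \<longrightarrow> s = Positive) \<and>
        (i \<in> U \<and> j \<in> W \<or> i \<in> W \<and> j \<in> U \<longrightarrow> s = Negative)"
    using bal unfolding structurally_balanced_def G_def [symmetric] by (elim exE conjE)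
  define u :: "real ^ 'n" where "u = (\<chi> i. if i \<in> U then 1 else - 1)"
  have W: "i \<in> W \<longleftrightarrow> i \<notin> U" for i using UW by auto
  have entry: "A t $ i $ j * u $ j = \<bar>A t $ i $ j\<bar> * u $ i" if "t \<in> T" for t i j
  proof (cases "A t $ i $ j = 0")
    case False
    then have "(j, i, sign_of (A t $ i $ j)) \<in> G"
      using that by (auto simp: G_def signed_digraph_of_def)
    from bspec [OF arcs this] False show ?thesis
      by (auto simp: W u_def sign_of_def split: if_splits)
  qed simp
  have "A t *v u = u" if "t \<in> T" for t
    using entry [OF that] row [OF that]
    by (simp add: vec_eq_iff matrix_vector_mult_def flip: sum_distrib_right)
  moreover have "u \<noteq> 0"
    by (auto simp: u_def vec_eq_iff)
  ultimately show ?thesis using that by blast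
qed

text \<open>The window length \<open>p\<close> is chosen with \<open>C \<rho>\<^sup>p < 1\<close>, so that a vector fixed
  throughout a window of this length would violate the decay estimate. No window of this length
  is balanced, wherever it starts; this is where uniformity in the initial time enters.\<close>

lemma exponential_convergence_imp_unbalanced:
  fixes A :: "nat \<Rightarrow> real ^ 'n ^ 'n"
  assumes row: "\<And>t i. t \<ge> 1 \<Longrightarrow> (\<Sum>j\<in>UNIV. \<bar>A t $ i $ j\<bar>) = 1"
    and conv: "converges_to_zero_exponentially_fast A"
  shows "repeatedly_jointly_structurally_unbalanced (\<lambda>t. signed_digraph_of (A t))"
proof -
  obtain C \<rho> where "0 \<le> \<rho>" "\<rho> < 1"
    and decay: "\<And>\<tau> x t. \<tau> \<ge> 1 \<Longrightarrow> solution_from \<tau> A x \<Longrightarrow> t \<ge> \<tau>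
      \<Longrightarrow> norm (x t) \<le> C * \<rho> ^ (t - \<tau>) * norm (x \<tau>)"
    using conv unfolding converges_to_zero_exponentially_fast_def by blast
  have "(\<lambda>p. C * \<rho> ^ p) \<longlonglongrightarrow> C * 0"
    by (intro tendsto_intros LIMSEQ_realpow_zero \<open>0 \<le> \<rho>\<close> \<open>\<rho> < 1\<close>)
  then have "\<forall>\<^sub>F p in sequentially. C * \<rho> ^ p < 1"
    by (rule order_tendstoD) simp
  with eventually_gt_at_top [of 0] have "\<forall>\<^sub>F p in sequentially. p > 0 \<and> C * \<rho> ^ p < 1"
    by eventually_elim simp
  then obtain p :: nat where "p > 0" and p: "C * \<rho> ^ p < 1"
    using eventually_happens' [OF sequentially_bot] by blast
  have "jointly_structurally_unbalanced
      (map (\<lambda>t. signed_digraph_of (A t)) [1 + k * p ..< 1 + (k + 1) * p])" for k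
  proof (rule ccontr)
    let ?\<tau> = "1 + k * p"
    let ?T = "{?\<tau> ..< ?\<tau> + p}"
    have T: "1 + (k + 1) * p = ?\<tau> + p" by simp
    assume "\<not> jointly_structurally_unbalanced
      (map (\<lambda>t. signed_digraph_of (A t)) [1 + k * p ..< 1 + (k + 1) * p])"
    then have "structurally_balanced (\<Union>t\<in>?T. signed_digraph_of (A t))"
      unfolding T jointly_structurally_unbalanced_def structurally_unbalanced_def
      by (simp del: upt_Suc)
    moreover have "(\<Sum>j\<in>UNIV. \<bar>A t $ i $ j\<bar>) = 1" if "t \<in> ?T" for t i
      using row that by simp
    ultimately obtain u where "u \<noteq> 0" and fixed: "\<And>t. t \<in> ?T \<Longrightarrow> A t *v u = u"
      using balanced_window_fixed_vector [of ?T A] by blast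
    obtain x where sol: "solution_from ?\<tau> A x" and "x ?\<tau> = u"
      by (rule solution_from_exists)
    have "x (?\<tau> + m) = u" if "m \<le> p" for m
      using that
    proof (induction m)
      case (Suc m)
      then show ?case
        using sol fixed [of "?\<tau> + m"] by (simp add: solution_from_def)
    qed (use \<open>x ?\<tau> = u\<close> in simp)
    then have "norm u \<le> C * \<rho> ^ p * norm u"
      using decay [of ?\<tau> x "?\<tau> + p"] sol \<open>x ?\<tau> = u\<close> by simp
    with p \<open>u \<noteq> 0\<close> show False by simp
  qed
  with \<open>p > 0\<close> show ?thesis
    unfolding repeatedly_jointly_structurally_unbalanced_def repeatedly_def
    by (intro exI [of _ p] conjI exI [of _ 1]) auto
qed

section \<open>The stability criterion\<close>

text \<open>Windows of a common length \<open>p\<close> are jointly strongly connected and jointly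
  unbalanced from time \<open>q\<close> on, so the sup norm contracts over blocks of length \<open>L\<close>
  starting after \<open>q\<close>, and it never increases. Comparing it with the Euclidean norm costs
  only a constant.\<close>

lemma unbalanced_imp_exponential_convergence:
  fixes A :: "nat \<Rightarrow> real ^ 'n ^ 'n"
  assumes diag: "\<And>t i. t \<ge> 1 \<Longrightarrow> A t $ i $ i > 0"
    and row: "\<And>t i. t \<ge> 1 \<Longrightarrow> (\<Sum>j\<in>UNIV. \<bar>A t $ i $ j\<bar>) = 1"
    and "\<beta> > 0"
    and beta: "\<And>t i j. t \<ge> 1 \<Longrightarrow> A t $ i $ j \<noteq> 0 \<Longrightarrow> \<bar>A t $ i $ j\<bar> \<ge> \<beta>"
    and sc: "repeatedly_jointly_strongly_connected (\<lambda>t. signed_digraph_of (A t))"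
    and ub: "repeatedly_jointly_structurally_unbalanced (\<lambda>t. signed_digraph_of (A t))"
  shows "converges_to_zero_exponentially_fast A"
proof -
  let ?G = "\<lambda>t. signed_digraph_of (A t)"
  obtain p1 q1 where 1: "\<And>t r. t \<ge> q1 \<Longrightarrow> r \<ge> p1
      \<Longrightarrow> jointly_strongly_connected (map ?G [t ..< t + r])"
    by (rule repeatedly_imp_all_long_windows
          [OF sc [unfolded repeatedly_jointly_strongly_connected_def]
            jointly_strongly_connected_mono]) blast+
  obtain p2 q2 where 2: "\<And>t r. t \<ge> q2 \<Longrightarrow> r \<ge> p2
      \<Longrightarrow> jointly_structurally_unbalanced (map ?G [t ..< t + r])"
    by (rule repeatedly_imp_all_long_windows
          [OF ub [unfolded repeatedly_jointly_structurally_unbalanced_def]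
            jointly_structurally_unbalanced_mono]) blast+
  define p where "p = Suc (max p1 p2)"
  define q where "q = Suc (max q1 q2)"
  have "q \<ge> 1" by (simp add: q_def)
  have windows: "jointly_strongly_connected (map ?G [t ..< t + p])"
      "jointly_structurally_unbalanced (map ?G [t ..< t + p])" if "t \<ge> q" for t
    using that by (auto intro!: 1 2 simp: p_def q_def simp del: upt_Suc add_Suc_right)
  define L where "L = card (UNIV :: ('n \<times> arc_sign) set) * p"
  have "L > 0"
    unfolding L_def p_def
    by (intro mult_pos_pos finite_UNIV_card_ge_0 finite_signed_vertices) simp
  have "\<beta> \<le> 1"
  proof -
    fix i :: 'n
    have "\<beta> \<le> \<bar>A 1 $ i $ i\<bar>" using beta [of 1 i i] diag [of 1 i] by auto
    also have "\<dots> \<le> (\<Sum>j\<in>UNIV. \<bar>A 1 $ i $ j\<bar>)" by (rule member_le_sum) auto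
    finally show ?thesis using row by simp
  qed
  \<comment> \<open>Halving \<open>\<beta>\<^sup>L\<close> keeps the contraction factor positive even for \<open>\<beta> = 1\<close>.\<close>
  define \<theta> where "\<theta> = 1 - \<beta> ^ L / 2"
  have \<theta>: "0 < \<theta>" "\<theta> < 1"
    using power_le_one [of \<beta> L] \<open>\<beta> > 0\<close> \<open>\<beta> \<le> 1\<close> by (auto simp: \<theta>_def)
  obtain C \<rho> where "C \<ge> 0" "0 \<le> \<rho>" "\<rho> < 1"
    and decay: "\<And>(f :: nat \<Rightarrow> real) \<tau> t. \<lbrakk>f \<tau> \<ge> 0; \<And>t. t \<ge> \<tau> \<Longrightarrow> f (Suc t) \<le> f t;
           \<And>t. t \<ge> \<tau> \<Longrightarrow> t \<ge> q \<Longrightarrow> f (t + L) \<le> \<theta> * f t; t \<ge> \<tau>\<rbrakk>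
           \<Longrightarrow> f t \<le> C * \<rho> ^ (t - \<tau>) * f \<tau>"
    by (rule geometric_decay_of_block_contraction [OF \<theta> \<open>L > 0\<close>, of q]) blast
  let ?K = "sqrt (DIM(real ^ 'n))"
  have "norm (x t) \<le> ?K * C * \<rho> ^ (t - \<tau>) * norm (x \<tau>)"
    if "\<tau> \<ge> 1" and sol: "solution_from \<tau> A x" and "t \<ge> \<tau>" for \<tau> x t
  proof -
    have "infnorm (x t) \<le> C * \<rho> ^ (t - \<tau>) * infnorm (x \<tau>)"
    proof (rule decay [of "\<lambda>t. infnorm (x t)"])
      show "0 \<le> infnorm (x \<tau>)" by (rule infnorm_pos_le)
    next
      fix t assume "t \<ge> \<tau>"
      then show "infnorm (x (Suc t)) \<le> infnorm (x t)"
        using sol row [of t] \<open>\<tau> \<ge> 1\<close>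
        by (intro infnorm_le_cart) (auto simp: solution_from_def abs_matrix_vector_le)
    next
      fix t assume "t \<ge> \<tau>" "t \<ge> q"
      then have sol': "solution_from t A x" using sol by (auto simp: solution_from_def)
      have "infnorm (x (t + L)) \<le> (1 - \<beta> ^ L) * infnorm (x t)"
        unfolding L_def
        by (rule infnorm_contraction [OF _ _ _ \<open>\<beta> > 0\<close> sol'])
           (use \<open>t \<ge> q\<close> \<open>q \<ge> 1\<close> diag row beta windows in auto)
      also have "\<dots> \<le> \<theta> * infnorm (x t)"
        using \<open>\<beta> > 0\<close> by (intro mult_right_mono infnorm_pos_le) (simp add: \<theta>_def)
      finally show "infnorm (x (t + L)) \<le> \<theta> * infnorm (x t)" .
    qed (rule \<open>t \<ge> \<tau>\<close>)
    also have "\<dots> \<le> C * \<rho> ^ (t - \<tau>) * norm (x \<tau>)"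
      using \<open>C \<ge> 0\<close> \<open>0 \<le> \<rho>\<close> by (intro mult_left_mono infnorm_le_norm) auto
    finally have "?K * infnorm (x t) \<le> ?K * (C * \<rho> ^ (t - \<tau>) * norm (x \<tau>))"
      by (rule mult_left_mono) simp
    then show ?thesis
      using norm_le_infnorm [of "x t"] unfolding mult.assoc by linarith
  qed
  moreover have "?K * C \<ge> 0" using \<open>C \<ge> 0\<close> by simp
  ultimately show ?thesis
    unfolding converges_to_zero_exponentially_fast_def
    using \<open>0 \<le> \<rho>\<close> \<open>\<rho> < 1\<close> by blast
qed

theorem theorem2:
  fixes A :: "nat \<Rightarrow> real ^ 'n ^ 'n" and \<beta> :: real
  assumes "CARD('n) > 1"
    and "\<And>t i. t \<ge> 1 \<Longrightarrow> A t $ i $ i > 0"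
    and "\<And>t i. t \<ge> 1 \<Longrightarrow> (\<Sum>j\<in>UNIV. \<bar>A t $ i $ j\<bar>) = 1"
    and "\<beta> > 0"
    and "\<And>t i j. t \<ge> 1 \<Longrightarrow> \<bar>A t $ i $ j\<bar> > 0 \<Longrightarrow> \<bar>A t $ i $ j\<bar> \<ge> \<beta>"
    and "repeatedly_jointly_strongly_connected (\<lambda>t. signed_digraph_of (A t))"
  shows "converges_to_zero_exponentially_fast A \<longleftrightarrow>
         repeatedly_jointly_structurally_unbalanced (\<lambda>t. signed_digraph_of (A t))"
proof
  assume "converges_to_zero_exponentially_fast A"
  with assms(3) show "repeatedly_jointly_structurally_unbalanced (\<lambda>t. signed_digraph_of (A t))"
    by (rule exponential_convergence_imp_unbalanced)
next
  assume "repeatedly_jointly_structurally_unbalanced (\<lambda>t. signed_digraph_of (A t))"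
  moreover have "\<And>t i j. t \<ge> 1 \<Longrightarrow> A t $ i $ j \<noteq> 0 \<Longrightarrow> \<bar>A t $ i $ j\<bar> \<ge> \<beta>"
    using assms(5) by simp
  ultimately show "converges_to_zero_exponentially_fast A"
    using assms(2-4,6) by (intro unbalanced_imp_exponential_convergence)
qed

end
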